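(* Let $C_{\mathcal{A}}=(\mathrm{Mat}_N(\mathbb{C}),\mathfrak{g}_D,M,\varphi)$ and $C'_{\mathcal{A}}=(\mathrm{Mat}_N(\mathbb{C}),\mathfrak{g}_{D'},M,\varphi')$ be free real calculi. Then $C_{\mathcal{A}}\simeq C'_{\mathcal{A}}$ if and only if the matrix representations $\hat{D}$ and $\hat{D}'$ (associated with $D$ and $D'$, respectively) are quasi-equivalent.
   Context: A hermitian derivation of a unital complex $*$-algebra $\mathcal{A}$ is a derivation $d$ with $d(a^* )=d(a)^*$. $\mathrm{Mat}_N(\mathbb{C})$ has conjugate transpose as its involution. Real calculus: let $\mathcal{A}$ be a unital $*$-algebra, $\mathfrak{g}$ a real Lie algebra with a faithful representation $D:\mathfrak{g}\to\mathrm{Der}(\mathcal{A})$ (written $\mathfrak{g}_D$) by hermitian derivations, $M$ a right $\mathcal{A}$-module, and $\varphi:\mathfrak{g}\to M$ an $\mathbb{R}$-linear map such that $\varphi(\mathfrak{g})$ generates $M$ as an $\mathcal{A}$-module. Then $(\mathcal{A},\mathfrak{g}_D,M,\varphi)$ is a real calculus. It is a free real calculus if $M$ is free and there is a basis $\{\partial_1,\dots,\partial_n\}$ of $\mathfrak{g}$ such that $\{\varphi(\partial_1),\dots,\varphi(\partial_n)\}$ is a basis of $M$. Isomorphism: real calculi $(\mathcal{A},\mathfrak{g}_D,M,\varphi)$ and $(\mathcal{A},\mathfrak{g}_{D'},M,\varphi')$ are isomorphic ($\simeq$) if there are a $*$-algebra automorphism $\phi$ of $\mathcal{A}$, a Lie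 algebra automorphism $\psi$ of $\mathfrak{g}$ with $\phi(D(\psi(\delta))(a))=D'(\delta)(\phi(a))$ for all $\delta\in\mathfrak{g}$, $a\in\mathcal{A}$, and an additive bijection $\hat{\psi}:M\to M$ with $\hat{\psi}(ma)=\hat{\psi}(m)\phi(a)$ for $m\in M$, $a\in\mathcal{A}$ and $\hat{\psi}(\varphi(\psi(\delta)))=\varphi'(\delta)$ for $\delta\in\mathfrak{g}$. Matrix representation: every derivation of $\mathrm{Mat}_N(\mathbb{C})$ is $[B,\cdot]$ for a unique trace-free matrix $B$. For a representation $D:\mathfrak{g}\to\mathrm{Der}(\mathrm{Mat}_N(\mathbb{C}))$, the associated matrix representation $\hat{D}:\mathfrak{g}\to\mathrm{Mat}_N(\mathbb{C})$ is the unique one with $\hat{D}(\partial)$ trace-free and $D(\partial)=[\hat{D}(\partial),\cdot]$ for all $\partial\in\mathfrak{g}$. Quasi-equivalence: for $U\in\mathrm{GL}_N(\mathbb{C})$ let $\phi_U(A)=U^{-1}AU$. Matrix representations $\hat{D},\hat{D}'$ of $\mathfrak{g}$ are quasi-equivalent if there are $U\in\mathrm{GL}_N(\mathbb{C})$ and a Lie algebra automorphism $\psi\in\mathrm{Aut}(\mathfrak{g})$ such that $\hat{D}'(\partial)=\phi_U(\hat{D}(\psi(\partial)))$ for every $\partial\in\mathfrak{g}$. *)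

theory Defs
  imports "HOL-Analysis.Analysis"
begin

section \<open>Unital star-algebras and their derivations\<close>

text \<open>The operations are explicit parameters because the type \<open>complex^'n^'n\<close>, which is the
  instance of interest, carries the componentwise product as its type class multiplication, and
  because there is no type class of complex vector spaces.\<close>

locale unital_star_algebra = vector_space sc
  for sc :: "complex \<Rightarrow> 'a::ab_group_add \<Rightarrow> 'a" +
  fixes mul :: "'a \<Rightarrow> 'a \<Rightarrow> 'a"
    and one :: 'a
    and star :: "'a \<Rightarrow> 'a"
  assumes mult_assoc: "mul (mul a b) c = mul a (mul b c)"
    and one_mult: "mul one a = a"
    and mult_one: "mul a one = a"
    and mult_add_left: "mul (a + b) c = mul a c + mul b c"
    and mult_add_right: "mul a (b + c) = mul a b + mul a c"
    and mult_scale_left: "mul (sc z a) b = sc z (mul a b)"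
    and mult_scale_right: "mul a (sc z b) = sc z (mul a b)"
    and star_star: "star (star a) = a"
    and star_add: "star (a + b) = star a + star b"
    and star_scale: "star (sc z a) = sc (cnj z) (star a)"
    and star_mult: "star (mul a b) = mul (star b) (star a)"

definition derivation ::
    "(complex \<Rightarrow> 'a \<Rightarrow> 'a) \<Rightarrow> ('a \<Rightarrow> 'a \<Rightarrow> 'a) \<Rightarrow> ('a::ab_group_add \<Rightarrow> 'a) \<Rightarrow> bool" where
  "derivation sc mul d \<longleftrightarrow>
     (\<forall>a b. d (a + b) = d a + d b) \<and>
     (\<forall>z a. d (sc z a) = sc z (d a)) \<and>
     (\<forall>a b. d (mul a b) = mul (d a) b + mul a (d b))"

definition hermitian_derivation ::
    "(complex \<Rightarrow> 'a \<Rightarrow> 'a) \<Rightarrow> ('a \<Rightarrow> 'a \<Rightarrow> 'a) \<Rightarrow> ('a \<Rightarrow> 'a) \<Rightarrow> ('a::ab_group_add \<Rightarrow> 'a) \<Rightarrow> bool"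
  where
  "hermitian_derivation sc mul star d \<longleftrightarrow>
     derivation sc mul d \<and> (\<forall>a. d (star a) = star (d a))"

definition star_automorphism ::
    "(complex \<Rightarrow> 'a \<Rightarrow> 'a) \<Rightarrow> ('a \<Rightarrow> 'a \<Rightarrow> 'a) \<Rightarrow> 'a \<Rightarrow> ('a \<Rightarrow> 'a) \<Rightarrow> ('a::ab_group_add \<Rightarrow> 'a) \<Rightarrow> bool"
  where
  "star_automorphism sc mul one star f \<longleftrightarrow>
     bij f \<and>
     (\<forall>a b. f (a + b) = f a + f b) \<and>
     (\<forall>z a. f (sc z a) = sc z (f a)) \<and>
     (\<forall>a b. f (mul a b) = mul (f a) (f b)) \<and>
     f one = one \<and>
     (\<forall>a. f (star a) = star (f a))"

section \<open>Real Lie algebras\<close>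

locale real_lie_algebra =
  fixes bracket :: "'g::real_vector \<Rightarrow> 'g \<Rightarrow> 'g"
  assumes bracket_bilinear: "bilinear bracket"
    and bracket_self: "bracket x x = 0"
    and jacobi: "bracket x (bracket y z) + bracket y (bracket z x) + bracket z (bracket x y) = 0"

definition lie_automorphism :: "('g::real_vector \<Rightarrow> 'g \<Rightarrow> 'g) \<Rightarrow> ('g \<Rightarrow> 'g) \<Rightarrow> bool" where
  "lie_automorphism bracket f \<longleftrightarrow>
     bij f \<and> linear f \<and> (\<forall>x y. f (bracket x y) = bracket (f x) (f y))"

section \<open>Right modules\<close>

text \<open>\<open>act m a\<close> is the product of the module element \<open>m\<close> with the algebra element \<open>a\<close> on its right.\<close>

locale right_module =
  fixes mul :: "'a::ab_group_add \<Rightarrow> 'a \<Rightarrow> 'a"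
    and one :: 'a
    and act :: "'m::ab_group_add \<Rightarrow> 'a \<Rightarrow> 'm"
  assumes act_add_left: "act (m + m') a = act m a + act m' a"
    and act_add_right: "act m (a + b) = act m a + act m b"
    and act_mult: "act m (mul a b) = act (act m a) b"
    and act_one: "act m one = m"

definition right_submodule :: "('m::ab_group_add \<Rightarrow> 'a \<Rightarrow> 'm) \<Rightarrow> 'm set \<Rightarrow> bool" where
  "right_submodule act S \<longleftrightarrow>
     0 \<in> S \<and> (\<forall>x\<in>S. \<forall>y\<in>S. x + y \<in> S) \<and> (\<forall>x\<in>S. \<forall>a. act x a \<in> S)"

definition generates_module :: "('m::ab_group_add \<Rightarrow> 'a \<Rightarrow> 'm) \<Rightarrow> 'm set \<Rightarrow> bool" where
  "generates_module act X \<longleftrightarrow> right_submodule act hull X = UNIV"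

text \<open>A basis is a finite indexed family \<open>(v i)\<^bsub>i \<in> I\<^esub>\<close>, not just its set of values, so that
  repetitions are excluded.\<close>

definition module_basis ::
    "('m::ab_group_add \<Rightarrow> 'a::ab_group_add \<Rightarrow> 'm) \<Rightarrow> 'i set \<Rightarrow> ('i \<Rightarrow> 'm) \<Rightarrow> bool" where
  "module_basis act I v \<longleftrightarrow>
     finite I \<and>
     generates_module act (v ` I) \<and>
     (\<forall>c. (\<Sum>i\<in>I. act (v i) (c i)) = 0 \<longrightarrow> (\<forall>i\<in>I. c i = 0))"

definition real_basis :: "'g::real_vector set \<Rightarrow> bool" where
  "real_basis B \<longleftrightarrow> finite B \<and> independent B \<and> span B = UNIV"

section \<open>Real calculi\<close>

text \<open>The real scalar \<open>r\<close> acts on the algebra as the complex scalar \<open>r\<close>, and on the module as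
  the algebra element \<open>r\<cdot>1\<close>; this is the meaning of real linearity for \<open>D\<close> and \<open>\<phi>\<close>.
  The carriers of the Lie algebra and of the module are the types \<open>'g\<close> and \<open>'m\<close>.\<close>

locale real_calculus =
  unital_star_algebra sc mul one star +
  real_lie_algebra bracket +
  right_module mul one act
  for sc :: "complex \<Rightarrow> 'a::ab_group_add \<Rightarrow> 'a"
    and mul :: "'a \<Rightarrow> 'a \<Rightarrow> 'a"
    and one :: 'a
    and star :: "'a \<Rightarrow> 'a"
    and bracket :: "'g::real_vector \<Rightarrow> 'g \<Rightarrow> 'g"
    and act :: "'m::ab_group_add \<Rightarrow> 'a \<Rightarrow> 'm" +
  fixes D :: "'g \<Rightarrow> 'a \<Rightarrow> 'a"
    and \<phi> :: "'g \<Rightarrow> 'm"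
  assumes D_hermitian: "hermitian_derivation sc mul star (D x)"
    and D_add: "D (x + y) a = D x a + D y a"
    and D_scaleR: "D (r *\<^sub>R x) a = sc (complex_of_real r) (D x a)"
    and D_bracket: "D (bracket x y) a = D x (D y a) - D y (D x a)"
    and D_faithful: "inj D"
    and \<phi>_add: "\<phi> (x + y) = \<phi> x + \<phi> y"
    and \<phi>_scaleR: "\<phi> (r *\<^sub>R x) = act (\<phi> x) (sc (complex_of_real r) one)"
    and \<phi>_generates: "generates_module act (range \<phi>)"

text \<open>Freeness of the module is implied by the existence of the basis \<open>(\<phi> b)\<^bsub>b \<in> B\<^esub>\<close>.\<close>

locale free_real_calculus = real_calculus +
  assumes free_basis: "\<exists>B. real_basis B \<and> module_basis act B \<phi>"

definition real_calculus_isomorphic ::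
    "(complex \<Rightarrow> 'a \<Rightarrow> 'a) \<Rightarrow> ('a \<Rightarrow> 'a \<Rightarrow> 'a) \<Rightarrow> 'a \<Rightarrow> ('a \<Rightarrow> 'a) \<Rightarrow>
     ('g::real_vector \<Rightarrow> 'g \<Rightarrow> 'g) \<Rightarrow> ('m::ab_group_add \<Rightarrow> 'a::ab_group_add \<Rightarrow> 'm) \<Rightarrow>
     ('g \<Rightarrow> 'a \<Rightarrow> 'a) \<Rightarrow> ('g \<Rightarrow> 'm) \<Rightarrow> ('g \<Rightarrow> 'a \<Rightarrow> 'a) \<Rightarrow> ('g \<Rightarrow> 'm) \<Rightarrow> bool" where
  "real_calculus_isomorphic sc mul one star bracket act D \<phi> D' \<phi>' \<longleftrightarrow>
     (\<exists>f \<psi> h.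
        star_automorphism sc mul one star f \<and>
        lie_automorphism bracket \<psi> \<and>
        (\<forall>\<delta> a. f (D (\<psi> \<delta>) a) = D' \<delta> (f a)) \<and>
        bij h \<and>
        (\<forall>m m'. h (m + m') = h m + h m') \<and>
        (\<forall>m a. h (act m a) = act (h m) (f a)) \<and>
        (\<forall>\<delta>. h (\<phi> (\<psi> \<delta>)) = \<phi>' \<delta>))"

section \<open>Matrix algebras\<close>

definition mat_scale :: "complex \<Rightarrow> complex^'n^'n \<Rightarrow> complex^'n^'n" where
  "mat_scale z A = map_matrix (\<lambda>x. z * x) A"

definition conj_transpose :: "complex^'n^'n \<Rightarrow> complex^'n^'n" where
  "conj_transpose A = map_matrix cnj (transpose A)"

lemma mat_scale_nth [simp]: "mat_scale z A $ i $ j = z * A $ i $ j"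
  by (simp add: mat_scale_def)

lemma conj_transpose_nth [simp]: "conj_transpose A $ i $ j = cnj (A $ j $ i)"
  by (simp add: conj_transpose_def transpose_def)

interpretation matrix_star_algebra: unital_star_algebra mat_scale "(**)" "mat 1" conj_transpose
proof
  fix A B C :: "complex^'n^'n" and z w :: complex
  show "mat_scale z (A + B) = mat_scale z A + mat_scale z B"
    and "mat_scale (z + w) A = mat_scale z A + mat_scale w A"
    and "mat_scale z (mat_scale w A) = mat_scale (z * w) A"
    and "mat_scale 1 A = A"
    and "conj_transpose (conj_transpose A) = A"
    and "conj_transpose (A + B) = conj_transpose A + conj_transpose B"
    and "conj_transpose (mat_scale z A) = mat_scale (cnj z) (conj_transpose A)"
    by (simp_all add: vec_eq_iff algebra_simps)
  show "A ** B ** C = A ** (B ** C)"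
    by (simp add: matrix_mul_assoc)
  show "mat 1 ** A = A" and "A ** mat 1 = A"
    by simp_all
  show "(A + B) ** C = A ** C + B ** C" and "A ** (B + C) = A ** B + A ** C"
    by (simp_all add: vec_eq_iff matrix_matrix_mult_def algebra_simps sum.distrib)
  show "mat_scale z A ** B = mat_scale z (A ** B)" and "A ** mat_scale z B = mat_scale z (A ** B)"
    by (simp_all add: vec_eq_iff matrix_matrix_mult_def sum_distrib_left mult_ac)
  show "conj_transpose (A ** B) = conj_transpose B ** conj_transpose A"
    by (simp add: vec_eq_iff matrix_matrix_mult_def mult.commute)
qed

abbreviation matrix_free_real_calculus ::
    "('g::real_vector \<Rightarrow> 'g \<Rightarrow> 'g) \<Rightarrow> ('m::ab_group_add \<Rightarrow> complex^'n^'n \<Rightarrow> 'm) \<Rightarrow>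
     ('g \<Rightarrow> complex^'n^'n \<Rightarrow> complex^'n^'n) \<Rightarrow> ('g \<Rightarrow> 'm) \<Rightarrow> bool" where
  "matrix_free_real_calculus \<equiv> free_real_calculus mat_scale (**) (mat 1) conj_transpose"

abbreviation matrix_real_calculus_isomorphic ::
    "('g::real_vector \<Rightarrow> 'g \<Rightarrow> 'g) \<Rightarrow> ('m::ab_group_add \<Rightarrow> complex^'n^'n \<Rightarrow> 'm) \<Rightarrow>
     ('g \<Rightarrow> complex^'n^'n \<Rightarrow> complex^'n^'n) \<Rightarrow> ('g \<Rightarrow> 'm) \<Rightarrow>
     ('g \<Rightarrow> complex^'n^'n \<Rightarrow> complex^'n^'n) \<Rightarrow> ('g \<Rightarrow> 'm) \<Rightarrow> bool" where
  "matrix_real_calculus_isomorphic \<equiv>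
     real_calculus_isomorphic mat_scale (**) (mat 1) conj_transpose"

text \<open>Every derivation of the matrix algebra is the commutator with a unique trace-free matrix,
  so the definite description in \<open>matrix_rep\<close> below is well-defined.\<close>

lemma matrix_diff_mult: "(A - B) ** C = A ** C - (B :: complex^'n^'n) ** (C :: complex^'n^'n)"
  by (simp add: vec_eq_iff matrix_matrix_mult_def algebra_simps sum_subtractf)

lemma matrix_mult_diff: "C ** (A - B) = (C :: complex^'n^'n) ** A - C ** (B :: complex^'n^'n)"
  by (simp add: vec_eq_iff matrix_matrix_mult_def algebra_simps sum_subtractf)

lemma matrix_sum_mult:
  fixes F :: "'i \<Rightarrow> complex^'n^'n" and C :: "complex^'n^'n"
  shows "(\<Sum>i\<in>I. F i) ** C = (\<Sum>i\<in>I. F i ** C)"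
  by (induction I rule: infinite_finite_induct)
     (simp_all add: matrix_star_algebra.mult_add_left)

lemma matrix_mult_sum:
  fixes F :: "'i \<Rightarrow> complex^'n^'n" and C :: "complex^'n^'n"
  shows "C ** (\<Sum>i\<in>I. F i) = (\<Sum>i\<in>I. C ** F i)"
  by (induction I rule: infinite_finite_induct)
     (simp_all add: matrix_star_algebra.mult_add_right)

definition matrix_unit :: "'n \<Rightarrow> 'n \<Rightarrow> complex^'n^'n" where
  "matrix_unit i j = (\<chi> k l. if k = i \<and> l = j then 1 else 0)"

lemma mult_matrix_unit: "(X ** matrix_unit k j) $ a $ b = (if b = j then X $ a $ k else 0)"
  by (auto simp: matrix_unit_def matrix_matrix_mult_def if_distrib cong: if_cong)

lemma matrix_unit_mult: "(matrix_unit k j ** X) $ a $ b = (if a = k then X $ j $ b else 0)"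
  by (auto simp: matrix_unit_def matrix_matrix_mult_def if_distrib if_distribR cong: if_cong)

lemma central_matrix_scalar:
  fixes B :: "complex^'n^'n"
  assumes "\<And>A. B ** A = A ** B"
  shows "B = mat_scale (B $ i $ i) (mat 1)"
proof -
  have "B $ a $ b = mat_scale (B $ i $ i) (mat 1) $ a $ b" for a b
  proof -
    have "(B ** matrix_unit b i) $ a $ i = (matrix_unit b i ** B) $ a $ i"
      using assms by simp
    then show ?thesis
      by (simp add: mult_matrix_unit matrix_unit_mult mat_def)
  qed
  then show ?thesis
    by (metis vec_eq_iff)
qed

lemma matrix_derivation_inner:
  fixes d :: "complex^'n^'n \<Rightarrow> complex^'n^'n"
  assumes "derivation mat_scale (**) d"
  shows "\<exists>!B. trace B = 0 \<and> (\<forall>A. d A = B ** A - A ** B)"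
proof -
  have add: "d (A + B) = d A + d B" and scl: "d (mat_scale z A) = mat_scale z (d A)"
    and leib: "d (A ** B) = d A ** B + A ** d B" for A B z
    using assms by (auto simp: derivation_def)
  have zero: "d 0 = 0"
    using add[of 0 0] by simp
  have dsum: "d (\<Sum>i\<in>I. F i) = (\<Sum>i\<in>I. d (F i))" for I :: "'n set" and F
    by (induction I rule: infinite_finite_induct) (auto simp: zero add)
  obtain j :: 'n where True by simp
  define E where "E = (matrix_unit :: 'n \<Rightarrow> 'n \<Rightarrow> complex^'n^'n)"
  define B where "B = (\<Sum>k\<in>UNIV. d (E k j) ** E j k)"
  have B: "d X = B ** X - X ** B" for X
  proof -
    have unit: "(\<Sum>k\<in>UNIV. E k j ** E j k) = mat 1"
      by (simp add: vec_eq_iff E_def mult_matrix_unit mat_def)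
         (auto simp: matrix_unit_def if_distrib cong: if_cong)
    have XE: "X ** E k j = (\<Sum>l\<in>UNIV. mat_scale (X $ l $ k) (E l j))" for k
      by (simp add: vec_eq_iff E_def mult_matrix_unit)
         (auto simp: matrix_unit_def if_distrib cong: if_cong)
    have EX: "E j l ** X = (\<Sum>k\<in>UNIV. mat_scale (X $ l $ k) (E j k))" for l
      by (simp add: vec_eq_iff E_def matrix_unit_mult)
         (auto simp: matrix_unit_def if_distrib cong: if_cong)
    have "X ** B = (\<Sum>k\<in>UNIV. (X ** d (E k j)) ** E j k)"
      by (simp add: B_def matrix_mult_sum matrix_mul_assoc)
    also have "\<dots> = (\<Sum>k\<in>UNIV. d (X ** E k j) ** E j k - d X ** (E k j ** E j k))"
      by (simp add: leib matrix_star_algebra.mult_add_left matrix_mul_assoc)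
    also have "\<dots> = (\<Sum>k\<in>UNIV. d (X ** E k j) ** E j k) - d X"
      by (simp add: sum_subtractf matrix_mult_sum[symmetric] unit)
    also have "(\<Sum>k\<in>UNIV. d (X ** E k j) ** E j k) =
        (\<Sum>k\<in>UNIV. \<Sum>l\<in>UNIV. mat_scale (X $ l $ k) (d (E l j) ** E j k))"
      by (simp add: XE dsum scl matrix_sum_mult matrix_star_algebra.mult_scale_left)
    also have "\<dots> = (\<Sum>l\<in>UNIV. \<Sum>k\<in>UNIV. mat_scale (X $ l $ k) (d (E l j) ** E j k))"
      by (rule sum.swap)
    also have "\<dots> = (\<Sum>l\<in>UNIV. d (E l j) ** (E j l ** X))"
      by (simp add: EX matrix_mult_sum matrix_star_algebra.mult_scale_right)
    also have "\<dots> = B ** X"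
      by (simp add: B_def matrix_sum_mult matrix_mul_assoc)
    finally show ?thesis by simp
  qed
  define c where "c = trace B / of_nat CARD('n)"
  define T where "T = B - mat_scale c (mat 1)"
  have "trace T = 0"
    by (simp add: T_def c_def trace_def sum_subtractf mat_def)
  moreover have "d A = T ** A - A ** T" for A
    by (simp add: B T_def matrix_diff_mult matrix_mult_diff
        matrix_star_algebra.mult_scale_left matrix_star_algebra.mult_scale_right)
  moreover have "S = T" if "trace S = 0" "\<forall>A. d A = S ** A - A ** S" for S
  proof -
    have comm: "(S - T) ** A = A ** (S - T)" for A
    proof -
      have "S ** A - A ** S = T ** A - A ** T"
        using that(2) \<open>\<And>A. d A = T ** A - A ** T\<close> by metis
      then show ?thesis
        by (simp add: matrix_diff_mult matrix_mult_diff algebra_simps)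
    qed
    have *: "S - T = mat_scale ((S - T) $ j $ j) (mat 1)"
      using central_matrix_scalar[OF comm] .
    have "trace (S - T) = of_nat CARD('n) * (S - T) $ j $ j"
      by (subst *) (simp add: trace_def mat_def)
    moreover have "trace (S - T) = 0"
      using that(1) \<open>trace T = 0\<close> by (simp add: trace_sub)
    ultimately have "(S - T) $ j $ j = 0"
      by simp
    then have "S - T = 0"
      by (subst *) (simp add: vec_eq_iff)
    then show ?thesis by simp
  qed
  ultimately show ?thesis by blast
qed

definition matrix_rep ::
    "('g \<Rightarrow> complex^'n^'n \<Rightarrow> complex^'n^'n) \<Rightarrow> 'g \<Rightarrow> complex^'n^'n" where
  "matrix_rep D x = (THE B. trace B = 0 \<and> (\<forall>A. D x A = B ** A - A ** B))"

definition quasi_equivalent ::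
    "('g::real_vector \<Rightarrow> 'g \<Rightarrow> 'g) \<Rightarrow> ('g \<Rightarrow> complex^'n^'n) \<Rightarrow> ('g \<Rightarrow> complex^'n^'n) \<Rightarrow> bool" where
  "quasi_equivalent bracket R R' \<longleftrightarrow>
     (\<exists>U \<psi>. invertible U \<and> lie_automorphism bracket \<psi> \<and>
        (\<forall>x. R' x = matrix_inv U ** R (\<psi> x) ** U))"

end

theory Submission
  imports Defs
begin

text \<open>Write \<open>R\<close> and \<open>R'\<close> for the matrix representations of \<open>D\<close> and \<open>D'\<close>.

  Suppose that \<open>f\<close>, \<open>\<psi>\<close> and \<open>h\<close> form an isomorphism. The automorphism \<open>f\<close> of the matrix algebra is
  inner (Skolem-Noether, \<open>matrix_algebra_endomorphism_inner\<close>), say conjugation by \<open>U\<close>. Applying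
  \<open>f\<close> to the commutator with \<open>R (\<psi> \<delta>)\<close> shows that \<open>D' \<delta>\<close> is the commutator with the matrix
  \<open>f (R (\<psi> \<delta>))\<close>. Conjugation preserves the trace, so this matrix is trace-free and is therefore
  \<open>R' \<delta>\<close>.

  The converse has two difficulties. The first is that the given \<open>U\<close> with
  \<open>R' x = U\<^sup>-\<^sup>1 R (\<psi> x) U\<close> is only invertible, so conjugation by \<open>U\<close> need not commute with the
  involution. But the derivations are Hermitian, so all the matrices \<open>R x\<close> and \<open>R' x\<close> are
  anti-Hermitian, and anti-Hermitian families that are conjugate by \<open>U\<close> are also conjugate by the
  unitary factor of the polar decomposition of \<open>U\<close>
  (\<open>similar_antihermitian_unitarily_equivalent\<close>). The positive factor is a square root of
  \<open>U U\<^sup>*\<close> that has to commute with everything that commutes with \<open>U U\<^sup>*\<close>; it is obtained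
  as a fixed point of a contraction (\<open>positive_definite_sqrt\<close>).

  The second is the map \<open>h\<close> on the module. It is forced to send \<open>\<phi> x\<close> to \<open>\<phi>' (\<psi>\<^sup>-\<^sup>1 x)\<close>, and as \<open>\<phi>\<close>
  takes a basis to a basis there is exactly one semilinear map that does so
  (\<open>semilinear_extension\<close>). The inverse comes from exchanging the two calculi, since
  a composite that fixes the generators \<open>\<phi> x\<close> is the identity.\<close>

section \<open>Algebra automorphisms of the matrix algebra are inner\<close>

lemma matrix_inv_mult:
  assumes "invertible (U :: complex^'n^'n)"
  shows "U ** matrix_inv U = mat 1" "matrix_inv U ** U = mat 1"
  using assms unfolding invertible_def matrix_inv_def
  by (metis (mono_tags, lifting) someI_ex)+

lemma matrix_inv_eqI:
  assumes "(V :: complex^'n^'n) ** U = mat 1"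
  shows "invertible U" "matrix_inv U = V"
proof -
  show inv: "invertible U"
    using assms invertible_left_inverse by blast
  have "matrix_inv U = V ** U ** matrix_inv U"
    by (simp add: assms)
  also have "\<dots> = V"
    by (simp add: matrix_inv_mult(1)[OF inv] flip: matrix_mul_assoc)
  finally show "matrix_inv U = V" .
qed

text \<open>A homomorphism \<open>f\<close> makes the column space into a second module over the matrix algebra, and
  since the column space is a simple module it is enough to find a nonzero matrix \<open>V\<close> that intertwines the two
  module structures, \<open>f X V = V X\<close>: its kernel is invariant, hence zero. Averaging any matrix \<open>C\<close> over
  the matrix units, \<open>V = \<Sum>\<^sub>k f (E\<^sub>k\<^sub>j) C E\<^sub>j\<^sub>k\<close>, gives an intertwiner.\<close>

lemma matrix_algebra_endomorphism_inner:
  fixes f :: "complex^'n^'n \<Rightarrow> complex^'n^'n"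
  assumes "inj f"
    and add: "\<And>A B. f (A + B) = f A + f B"
    and scl: "\<And>z A. f (mat_scale z A) = mat_scale z (f A)"
    and mult: "\<And>A B. f (A ** B) = f A ** f B"
  shows "\<exists>U. invertible U \<and> (\<forall>A. f A = matrix_inv U ** A ** U)"
proof -
  have zero: "f 0 = 0"
    using add[of 0 0] by simp
  have fsum: "f (\<Sum>i\<in>I. F i) = (\<Sum>i\<in>I. f (F i))" for I :: "'n set" and F
    by (induction I rule: infinite_finite_induct) (auto simp: zero add)
  obtain j :: 'n where True by simp
  define E where "E = (matrix_unit :: 'n \<Rightarrow> 'n \<Rightarrow> complex^'n^'n)"
  have "E j j \<noteq> 0"
    by (auto simp: E_def matrix_unit_def vec_eq_iff)
  then have "f (E j j) \<noteq> 0"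
    using \<open>inj f\<close> zero by (metis injD)
  then obtain a b where ab: "f (E j j) $ a $ b \<noteq> 0"
    by (auto simp: vec_eq_iff)
  \<comment> \<open>With \<open>E b j\<close> in the middle, column \<open>j\<close> of \<open>V\<close> is column \<open>b\<close> of \<open>f (E j j)\<close>, so \<open>V\<close> is nonzero.\<close>
  define V where "V = (\<Sum>k\<in>UNIV. f (E k j) ** E b j ** E j k)"
  have intertwine: "f X ** V = V ** X" for X
  proof -
    have XE: "X ** E k j = (\<Sum>l\<in>UNIV. mat_scale (X $ l $ k) (E l j))" for k
      by (simp add: vec_eq_iff E_def mult_matrix_unit)
         (auto simp: matrix_unit_def if_distrib cong: if_cong)
    have EX: "E j l ** X = (\<Sum>k\<in>UNIV. mat_scale (X $ l $ k) (E j k))" for l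
      by (simp add: vec_eq_iff E_def matrix_unit_mult)
         (auto simp: matrix_unit_def if_distrib cong: if_cong)
    have "f X ** V = (\<Sum>k\<in>UNIV. f (X ** E k j) ** E b j ** E j k)"
      by (simp add: V_def matrix_mult_sum matrix_mul_assoc mult)
    also have "\<dots> = (\<Sum>k\<in>UNIV. \<Sum>l\<in>UNIV. mat_scale (X $ l $ k) (f (E l j) ** E b j ** E j k))"
      by (simp add: XE fsum scl matrix_sum_mult matrix_star_algebra.mult_scale_left)
    also have "\<dots> = (\<Sum>l\<in>UNIV. \<Sum>k\<in>UNIV. mat_scale (X $ l $ k) (f (E l j) ** E b j ** E j k))"
      by (rule sum.swap)
    also have "\<dots> = (\<Sum>l\<in>UNIV. f (E l j) ** E b j ** (E j l ** X))"
      by (simp add: EX matrix_mult_sum matrix_star_algebra.mult_scale_right)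
    also have "\<dots> = V ** X"
      by (simp add: V_def matrix_sum_mult matrix_mul_assoc)
    finally show ?thesis .
  qed
  have "V $ a $ j = (\<Sum>k\<in>UNIV. if j = k then f (E k j) $ a $ b else 0)"
    by (auto simp: V_def E_def mult_matrix_unit intro!: sum.cong)
  then have Vaj: "V $ a $ j \<noteq> 0"
    using ab by simp
  \<comment> \<open>If \<open>V\<close> kills \<open>w \<noteq> 0\<close>, it also kills the unit vector at \<open>j\<close>, which is a multiple of \<open>E j i w\<close>.\<close>
  have "w = 0" if w: "V *v w = 0" for w
  proof (rule ccontr)
    assume "w \<noteq> 0"
    then obtain i where i: "w $ i \<noteq> 0"
      by (auto simp: vec_eq_iff)
    have "(V ** E j i) *v w = f (E j i) *v (V *v w)"
      by (simp add: intertwine matrix_vector_mul_assoc)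
    then have "((V ** E j i) *v w) $ a = 0"
      by (simp add: w)
    moreover have "((V ** E j i) *v w) $ a = V $ a $ j * w $ i"
      by (simp add: matrix_vector_mult_def E_def mult_matrix_unit mult_delta_left)
    ultimately show False
      using Vaj i by simp
  qed
  then obtain U where UV: "U ** V = mat 1"
    using matrix_left_invertible_ker[of V] by blast
  then have VU: "V ** U = mat 1"
    using matrix_left_right_inverse by blast
  have "f X = V ** X ** U" for X
  proof -
    have "f X = f X ** V ** U"
      by (simp add: VU flip: matrix_mul_assoc)
    then show ?thesis
      by (simp add: intertwine)
  qed
  then show ?thesis
    using matrix_inv_eqI[OF VU] by metis
qed

section \<open>Unitary equivalence of similar anti-Hermitian matrices\<close>

text \<open>The inner product of the real vector space of complex column vectors is the real part of the Hermitian
  one, so the Hermitian adjoint is also the adjoint for it.\<close>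

lemma inner_conj_transpose:
  fixes A :: "complex^'n^'n"
  shows "inner (A *v x) y = inner x (conj_transpose A *v y)"
proof -
  have "inner (A *v x) y = (\<Sum>i\<in>UNIV. \<Sum>j\<in>UNIV. inner (A $ i $ j * x $ j) (y $ i))"
    by (simp add: inner_vec_def matrix_vector_mult_def inner_sum_left)
  also have "\<dots> = (\<Sum>j\<in>UNIV. \<Sum>i\<in>UNIV. inner (A $ i $ j * x $ j) (y $ i))"
    by (rule sum.swap)
  also have "\<dots> = (\<Sum>j\<in>UNIV. \<Sum>i\<in>UNIV. inner (x $ j) (cnj (A $ i $ j) * y $ i))"
    by (simp add: inner_complex_def algebra_simps)
  also have "\<dots> = inner x (conj_transpose A *v y)"
    by (simp add: inner_vec_def matrix_vector_mult_def inner_sum_right)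
  finally show ?thesis .
qed

lemma matrix_vector_norm_bound:
  fixes A :: "complex^'n^'n"
  obtains K where "K > 0" "\<And>v. norm (A *v v) \<le> K * norm v"
proof -
  have "bounded_linear ((*v) A)"
    by simp
  from bounded_linear.pos_bounded[OF this] obtain K where
    "K > 0" "\<forall>v. norm (A *v v) \<le> norm v * K" by blast
  then show ?thesis
    by (intro that[of K]) (auto simp: mult.commute)
qed

lemma matrix_norm_eq_columns:
  fixes B :: "complex^'n^'n"
  shows "(norm B)\<^sup>2 = (\<Sum>j\<in>UNIV. (norm (column j B))\<^sup>2)"
proof -
  have "(norm B)\<^sup>2 = (\<Sum>i\<in>UNIV. \<Sum>j\<in>UNIV. (norm (B $ i $ j))\<^sup>2)"
    by (simp add: norm_vec_def L2_set_def sum_nonneg)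
  also have "\<dots> = (\<Sum>j\<in>UNIV. \<Sum>i\<in>UNIV. (norm (B $ i $ j))\<^sup>2)"
    by (rule sum.swap)
  also have "\<dots> = (\<Sum>j\<in>UNIV. (norm (column j B))\<^sup>2)"
    by (simp add: norm_vec_def L2_set_def sum_nonneg column_def)
  finally show ?thesis .
qed

text \<open>The norm of the type of matrices is the Frobenius norm, which makes that type a complete metric
  space but is too large for the contraction below: the identity has norm \<open>\<surd>n\<close>. The size of a
  factor is therefore measured by its operator norm, here in the form of a bound on all vectors.\<close>

lemma matrix_mult_norm_le:
  fixes A B :: "complex^'n^'n"
  assumes A: "\<And>v. norm (A *v v) \<le> s * norm v" and "0 \<le> s"
  shows "norm (A ** B) \<le> s * norm B"
proof (rule power2_le_imp_le)
  have col: "column j (A ** B) = A *v column j B" for j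
    by (simp add: column_def vec_eq_iff matrix_vector_mult_def matrix_matrix_mult_def)
  have "(norm (A ** B))\<^sup>2 \<le> (\<Sum>j\<in>UNIV. (s * norm (column j B))\<^sup>2)"
    unfolding matrix_norm_eq_columns col by (intro sum_mono power_mono A) auto
  also have "\<dots> = (s * norm B)\<^sup>2"
    by (simp add: power_mult_distrib matrix_norm_eq_columns sum_distrib_left)
  finally show "(norm (A ** B))\<^sup>2 \<le> (s * norm B)\<^sup>2" .
qed (use \<open>0 \<le> s\<close> in simp)

lemma matrix_scaleR_mult:
  fixes A B :: "complex^'n^'n"
  shows "(r *\<^sub>R A) ** B = r *\<^sub>R (A ** B)" "A ** (r *\<^sub>R B) = r *\<^sub>R (A ** B)"
  by (simp_all add: vec_eq_iff matrix_matrix_mult_def scaleR_sum_right)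

lemma matrix_minus_mult:
  fixes A B :: "complex^'n^'n"
  shows "(- A) ** B = - (A ** B)" "A ** (- B) = - (A ** B)"
  by (simp_all add: vec_eq_iff matrix_matrix_mult_def sum_negf)

lemma matrix_scaleR_vector:
  fixes A :: "complex^'n^'n"
  shows "(r *\<^sub>R A) *v v = r *\<^sub>R (A *v v)"
  by (simp add: vec_eq_iff matrix_vector_mult_def scaleR_sum_right)

lemma conj_transpose_simps [simp]:
  fixes A B :: "complex^'n^'n"
  shows "conj_transpose (r *\<^sub>R A) = r *\<^sub>R conj_transpose A"
    "conj_transpose (A - B) = conj_transpose A - conj_transpose B"
    "conj_transpose (- A) = - conj_transpose A"
    "conj_transpose (mat 1 :: complex^'n^'n) = mat 1"
  by (auto simp: vec_eq_iff mat_def)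

lemma continuous_on_matrix_mult:
  fixes f g :: "'a::topological_space \<Rightarrow> complex^'n^'n"
  assumes "continuous_on S f" "continuous_on S g"
  shows "continuous_on S (\<lambda>x. f x ** g x)"
  unfolding matrix_matrix_mult_def by (intro continuous_intros assms)

lemma continuous_on_matrix_vector_mult:
  fixes f :: "'a::topological_space \<Rightarrow> complex^'n^'n"
  assumes "continuous_on S f"
  shows "continuous_on S (\<lambda>x. f x *v v)"
  unfolding matrix_vector_mult_def by (intro continuous_intros assms)

lemma continuous_on_conj_transpose:
  "continuous_on S (conj_transpose :: complex^'n^'n \<Rightarrow> complex^'n^'n)"
proof -
  have "conj_transpose = (\<lambda>A::complex^'n^'n. \<chi> i j. cnj (A $ j $ i))"
    by (auto simp: vec_eq_iff)
  then show ?thesis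
    by (rule ssubst) (intro continuous_intros)
qed

text \<open>Writing the square root of \<open>1 - N\<close> as \<open>1 - Y\<close> turns \<open>(1 - Y)\<^sup>2 = 1 - N\<close> into the fixed point
  equation \<open>Y = (N + Y\<^sup>2) / 2\<close>. The right-hand side is a contraction on matrices of operator norm at
  most \<open>s < 1\<close>, and it preserves the closed conditions of being Hermitian and of commuting with all
  that commutes with \<open>N\<close>, so the fixed point inherits them. The last condition replaces the usual
  statement that the square root is a polynomial in the matrix.\<close>

lemma hermitian_sqrt_one_minus:
  fixes N :: "complex^'n^'n"
  assumes herm: "conj_transpose N = N"
    and s: "0 \<le> s" "s < 1" and bound: "\<And>v. norm (N *v v) \<le> s * norm v"
  shows "\<exists>Q. conj_transpose Q = Q \<and> Q ** Q = mat 1 - N \<and>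
    (\<forall>X. X ** N = N ** X \<longrightarrow> X ** Q = Q ** X)"
proof -
  define f where "f Y = (1/2) *\<^sub>R (N + Y ** Y)" for Y
  define S where "S = {Y. (\<forall>v. norm (Y *v v) \<le> s * norm v)} \<inter> {Y. conj_transpose Y = Y} \<inter>
    {Y. \<forall>X. X ** N = N ** X \<longrightarrow> X ** Y = Y ** X}"
  have S_norm: "norm (Y *v v) \<le> s * norm v" and S_herm: "conj_transpose Y = Y"
    and S_comm: "X ** N = N ** X \<Longrightarrow> X ** Y = Y ** X" if "Y \<in> S" for X Y v
    using that unfolding S_def by blast+
  have "closed S"
    unfolding S_def
    by (intro closed_Int closed_Collect_all closed_Collect_imp closed_Collect_le closed_Collect_eq
        open_Collect_const continuous_on_matrix_mult continuous_on_matrix_vector_mult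
        continuous_on_conj_transpose continuous_intros)
  moreover have "0 \<in> S"
    using s by (auto simp: S_def vec_eq_iff)
  moreover have "f Y \<in> S" if Y: "Y \<in> S" for Y
  proof -
    have "norm (f Y *v v) \<le> s * norm v" for v
    proof -
      have "norm (Y *v (Y *v v)) \<le> s * norm (Y *v v)"
        by (rule S_norm[OF Y])
      also have "\<dots> \<le> s * (s * norm v)"
        using s by (intro mult_left_mono S_norm[OF Y])
      also have "\<dots> \<le> 1 * (s * norm v)"
        using s by (intro mult_right_mono) auto
      finally have "norm (Y *v (Y *v v)) \<le> s * norm v" by simp
      moreover have "f Y *v v = (1/2) *\<^sub>R (N *v v + Y *v (Y *v v))"
        by (simp add: f_def matrix_scaleR_vector matrix_vector_mult_add_rdistrib
            matrix_vector_mul_assoc)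
      ultimately show ?thesis
        using norm_triangle_ineq[of "N *v v" "Y *v (Y *v v)"] bound[of v] by simp
    qed
    moreover have "conj_transpose (f Y) = f Y"
      by (simp add: f_def S_herm[OF Y] herm matrix_star_algebra.star_add
          matrix_star_algebra.star_mult)
    moreover have "X ** f Y = f Y ** X" if X: "X ** N = N ** X" for X
    proof -
      have XY: "X ** Y = Y ** X"
        by (rule S_comm[OF Y X])
      have "X ** (Y ** Y) = Y ** Y ** X"
        by (metis XY matrix_mul_assoc)
      then show ?thesis
        by (simp add: f_def matrix_scaleR_mult X matrix_star_algebra.mult_add_left
            matrix_star_algebra.mult_add_right)
    qed
    ultimately show ?thesis
      unfolding S_def by blast
  qed
  moreover have "dist (f Y) (f Z) \<le> s * dist Y Z" if Y: "Y \<in> S" and Z: "Z \<in> S" for Y Z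
  proof -
    \<comment> \<open>Members of \<open>S\<close> commute with each other, which allows factoring the difference of squares.\<close>
    have "N ** Z = Z ** N"
      by (rule S_comm[OF Z refl])
    then have YZ: "Z ** Y = Y ** Z"
      by (intro S_comm[OF Y]) simp
    have "f Y - f Z = (1/2) *\<^sub>R (Y ** Y - Z ** Z)"
      by (simp add: f_def scaleR_diff_right[symmetric])
    also have "Y ** Y - Z ** Z = (Y + Z) ** (Y - Z)"
      by (simp add: matrix_star_algebra.mult_add_left matrix_mult_diff YZ)
    finally have "f Y - f Z = (1/2) *\<^sub>R ((Y + Z) ** (Y - Z))" .
    moreover have "norm ((Y + Z) ** (Y - Z)) \<le> (2 * s) * norm (Y - Z)"
    proof (rule matrix_mult_norm_le)
      fix v
      have "norm ((Y + Z) *v v) \<le> norm (Y *v v) + norm (Z *v v)"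
        by (simp add: matrix_vector_mult_add_rdistrib norm_triangle_ineq)
      also have "\<dots> \<le> s * norm v + s * norm v"
        by (intro add_mono S_norm Y Z)
      finally show "norm ((Y + Z) *v v) \<le> 2 * s * norm v"
        by simp
    qed (use s in simp)
    ultimately show ?thesis
      by (simp add: dist_norm)
  qed
  ultimately have "\<exists>!Y. Y \<in> S \<and> f Y = Y"
    using s by (intro Banach_fix[of S s f]) (auto simp: complete_eq_closed)
  then obtain Y where Y: "Y \<in> S" "f Y = Y" by blast
  have "N + Y ** Y = 2 *\<^sub>R f Y"
    by (simp add: f_def)
  also have "\<dots> = Y + Y"
    by (simp add: Y(2) scaleR_2)
  finally have "Y ** Y = Y + Y - N"
    by (simp add: algebra_simps)
  then have "(mat 1 - Y) ** (mat 1 - Y) = mat 1 - N"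
    by (simp add: matrix_diff_mult matrix_mult_diff algebra_simps)
  moreover have "conj_transpose (mat 1 - Y) = mat 1 - Y"
    by (simp add: S_herm[OF Y(1)])
  moreover have "X ** (mat 1 - Y) = (mat 1 - Y) ** X" if "X ** N = N ** X" for X
    by (simp add: S_comm[OF Y(1) that] matrix_diff_mult matrix_mult_diff)
  ultimately show ?thesis by blast
qed

text \<open>The matrix \<open>P = U U\<^sup>*\<close> is bounded below since \<open>U\<close> is invertible, so a small multiple of \<open>P\<close> has
  the form \<open>1 - N\<close> with \<open>N\<close> a strict contraction. If \<open>K\<close> bounds \<open>U\<close>, the factor \<open>1 / K\<^sup>2\<close> is small
  enough: with \<open>u = U\<^sup>* v\<close> one has \<open>\<langle>v, P v\<rangle> = \<bar>u\<bar>\<^sup>2\<close> and \<open>\<bar>P v\<bar> = \<bar>U u\<bar> \<le> K \<bar>u\<bar>\<close>, so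
  \<open>\<bar>N v\<bar>\<^sup>2 \<le> \<bar>v\<bar>\<^sup>2 - \<bar>u\<bar>\<^sup>2 / K\<^sup>2\<close>, and \<open>\<bar>u\<bar>\<close> is at least a fixed multiple of \<open>\<bar>v\<bar>\<close>.\<close>

lemma positive_definite_sqrt:
  fixes U :: "complex^'n^'n"
  assumes "invertible U"
  defines "P \<equiv> U ** conj_transpose U"
  shows "\<exists>Q. conj_transpose Q = Q \<and> Q ** Q = P \<and> (\<forall>X. X ** P = P ** X \<longrightarrow> X ** Q = Q ** X)"
proof -
  define U' where "U' = conj_transpose U"
  define V' where "V' = conj_transpose (matrix_inv U)"
  have V'U': "V' ** U' = mat 1"
    using matrix_inv_mult[OF assms(1)]
    by (simp add: U'_def V'_def flip: matrix_star_algebra.star_mult)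
  obtain K where K: "K > 0" "\<And>v. norm (U *v v) \<le> K * norm v"
    using matrix_vector_norm_bound[of U] by blast
  obtain L where L: "L > 0" "\<And>v. norm (V' *v v) \<le> L * norm v"
    using matrix_vector_norm_bound[of V'] by blast
  define N where "N = mat 1 - (1/K\<^sup>2) *\<^sub>R P"
  \<comment> \<open>The maximum with \<open>0\<close> avoids having to show \<open>K * L \<ge> 1\<close>.\<close>
  define s where "s = sqrt (max 0 (1 - 1 / (K * L)\<^sup>2))"
  have s: "0 \<le> s" "s < 1" "1 - 1 / (K * L)\<^sup>2 \<le> s\<^sup>2"
    using K L by (auto simp: s_def real_sqrt_less_iff)
  have P_herm: "conj_transpose P = P"
    by (simp add: P_def matrix_star_algebra.star_mult matrix_star_algebra.star_star)
  have N_bound: "norm (N *v v) \<le> s * norm v" for v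
  proof (rule power2_le_imp_le)
    define u where "u = U' *v v"
    have Pv: "P *v v = U *v u"
      by (simp add: P_def u_def U'_def matrix_vector_mul_assoc)
    have ip: "inner v (P *v v) = (norm u)\<^sup>2"
      by (simp add: Pv u_def U'_def power2_norm_eq_inner inner_conj_transpose
          matrix_star_algebra.star_star inner_commute)
    have "norm v = norm (V' *v u)"
      by (simp add: u_def matrix_vector_mul_assoc V'U')
    then have "(norm v)\<^sup>2 \<le> (L * norm u)\<^sup>2"
      using L(2) by (metis norm_ge_zero power_mono)
    then have lower: "(norm v)\<^sup>2 / (K * L)\<^sup>2 \<le> (norm u)\<^sup>2 / K\<^sup>2"
      using K L by (simp add: field_simps power_mult_distrib)
    have upper: "(norm (P *v v))\<^sup>2 \<le> K\<^sup>2 * (norm u)\<^sup>2"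
      using K(2)[of u] by (simp add: Pv power_mono flip: power_mult_distrib)
    have "N *v v = v - (1/K\<^sup>2) *\<^sub>R (P *v v)"
      by (simp add: N_def matrix_vector_mult_diff_rdistrib matrix_scaleR_vector)
    then have "(norm (N *v v))\<^sup>2 =
        (norm v)\<^sup>2 - 2 * (1/K\<^sup>2) * (norm u)\<^sup>2 + (1/K\<^sup>2)\<^sup>2 * (norm (P *v v))\<^sup>2"
      by (simp only: power2_norm_eq_inner[of "_ - _"] flip: ip)
        (simp add: inner_diff_left inner_diff_right inner_commute power2_norm_eq_inner
          power2_eq_square[of "1/_"] algebra_simps)
    also have "\<dots> \<le> (norm v)\<^sup>2 - 2 * (1/K\<^sup>2) * (norm u)\<^sup>2 + (1/K\<^sup>2)\<^sup>2 * (K\<^sup>2 * (norm u)\<^sup>2)"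
      using upper by (intro add_left_mono mult_left_mono) auto
    also have "\<dots> = (norm v)\<^sup>2 - (norm u)\<^sup>2 / K\<^sup>2"
      using K by (simp add: power2_eq_square field_simps)
    also have "\<dots> \<le> (1 - 1 / (K * L)\<^sup>2) * (norm v)\<^sup>2"
      using lower by (simp add: algebra_simps)
    also have "\<dots> \<le> s\<^sup>2 * (norm v)\<^sup>2"
      using s(3) by (intro mult_right_mono) auto
    finally show "(norm (N *v v))\<^sup>2 \<le> (s * norm v)\<^sup>2"
      by (simp add: power_mult_distrib)
  qed (use s in simp)
  have "conj_transpose N = N"
    by (simp add: N_def P_herm)
  from hermitian_sqrt_one_minus[OF this s(1,2) N_bound] obtain Q where
    Q: "conj_transpose Q = Q" "Q ** Q = mat 1 - N" "\<And>X. X ** N = N ** X \<Longrightarrow> X ** Q = Q ** X"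
    by blast
  have "(K *\<^sub>R Q) ** (K *\<^sub>R Q) = P"
    using K by (simp add: matrix_scaleR_mult Q(2) N_def power2_eq_square)
  moreover have "X ** (K *\<^sub>R Q) = (K *\<^sub>R Q) ** X" if "X ** P = P ** X" for X
    using that Q(3)[of X]
    by (simp add: matrix_scaleR_mult N_def matrix_diff_mult matrix_mult_diff)
  moreover have "conj_transpose (K *\<^sub>R Q) = K *\<^sub>R Q"
    by (simp add: Q(1))
  ultimately show ?thesis by blast
qed

text \<open>Taking adjoints in \<open>Y = U\<^sup>-\<^sup>1 X U\<close> gives \<open>Y = U\<^sup>* X (U\<^sup>*)\<^sup>-\<^sup>1\<close>, since the two signs cancel.
  Comparing the two expressions shows that \<open>X\<close> commutes with \<open>P = U U\<^sup>*\<close>, hence with its square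
  root \<open>Q\<close>. The matrix \<open>W = Q\<^sup>-\<^sup>1 U\<close> is unitary and conjugates \<open>X\<close> in the same way as \<open>U\<close> does. It
  equals \<open>Q (U\<^sup>*)\<^sup>-\<^sup>1\<close>, a form that does not mention the inverse of \<open>Q\<close>.\<close>

lemma similar_antihermitian_unitarily_equivalent:
  fixes X Y :: "'i \<Rightarrow> complex^'n^'n"
  assumes U: "invertible U"
    and X: "\<And>i. conj_transpose (X i) = - X i"
    and Y: "\<And>i. conj_transpose (Y i) = - Y i"
    and sim: "\<And>i. Y i = matrix_inv U ** X i ** U"
  shows "\<exists>W. conj_transpose W ** W = mat 1 \<and> W ** conj_transpose W = mat 1 \<and>
    (\<forall>i. Y i = conj_transpose W ** X i ** W)"
proof -
  define V where "V = matrix_inv U"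
  define P where "P = U ** conj_transpose U"
  have UV: "U ** V = mat 1" and VU: "V ** U = mat 1"
    using matrix_inv_mult[OF U] by (auto simp: V_def)
  have V'U': "conj_transpose V ** conj_transpose U = mat 1"
    and U'V': "conj_transpose U ** conj_transpose V = mat 1"
    using UV VU by (simp_all flip: matrix_star_algebra.star_mult)
  have comm: "X i ** P = P ** X i" for i
  proof -
    have "- Y i = conj_transpose (V ** X i ** U)"
      using Y sim by (simp add: V_def)
    also have "\<dots> = - (conj_transpose U ** X i ** conj_transpose V)"
      by (simp add: matrix_star_algebra.star_mult X matrix_mul_assoc matrix_minus_mult)
    finally have "V ** X i ** U = conj_transpose U ** X i ** conj_transpose V"
      using sim by (simp add: V_def)
    then have "U ** (V ** X i ** U) ** conj_transpose U =
        U ** (conj_transpose U ** X i ** conj_transpose V) ** conj_transpose U"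
      by simp
    moreover have "U ** (V ** X i ** U) ** conj_transpose U = (U ** V) ** X i ** P"
      by (simp add: P_def matrix_mul_assoc)
    moreover have "U ** (conj_transpose U ** X i ** conj_transpose V) ** conj_transpose U =
        P ** X i ** (conj_transpose V ** conj_transpose U)"
      by (simp add: P_def matrix_mul_assoc)
    ultimately show ?thesis
      by (simp add: UV V'U')
  qed
  obtain Q where Q: "conj_transpose Q = Q" "Q ** Q = P" and QX: "\<And>i. X i ** Q = Q ** X i"
    using positive_definite_sqrt[OF U] comm unfolding P_def by blast
  define W where "W = Q ** conj_transpose V"
  have W': "conj_transpose W = V ** Q"
    by (simp add: W_def matrix_star_algebra.star_mult matrix_star_algebra.star_star Q(1))
  have conj: "conj_transpose W ** A ** W = V ** A ** U" if "A ** Q = Q ** A" for A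
  proof -
    have "conj_transpose W ** A ** W = V ** (Q ** A) ** Q ** conj_transpose V"
      unfolding W' by (simp add: W_def matrix_mul_assoc)
    also have "\<dots> = V ** A ** (Q ** Q) ** conj_transpose V"
      by (metis that matrix_mul_assoc)
    also have "\<dots> = V ** A ** U ** (conj_transpose U ** conj_transpose V)"
      by (simp add: Q(2) P_def matrix_mul_assoc)
    finally show ?thesis
      by (simp add: U'V')
  qed
  have "conj_transpose W ** W = mat 1"
    using conj[of "mat 1"] by (simp add: VU)
  moreover from this have "W ** conj_transpose W = mat 1"
    by (rule matrix_left_right_inverse1)
  moreover have "Y i = conj_transpose W ** X i ** W" for i
    using conj[OF QX] sim by (simp add: V_def)
  ultimately show ?thesis by blast
qed

section \<open>The matrix representation of a real calculus\<close>

lemma matrix_rep_properties: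
  assumes "derivation mat_scale (**) (D x)"
  shows "trace (matrix_rep D x) = 0"
    and "D x A = matrix_rep D x ** A - A ** matrix_rep D x"
  using theI'[OF matrix_derivation_inner[OF assms]] unfolding matrix_rep_def by blast+

lemma matrix_rep_eqI:
  assumes "derivation mat_scale (**) (D x)"
    and "trace B = 0" "\<And>A. D x A = B ** A - A ** B"
  shows "matrix_rep D x = B"
  unfolding matrix_rep_def
  by (rule the1_equality[OF matrix_derivation_inner[OF assms(1)]]) (use assms(2,3) in blast)

text \<open>For a Hermitian derivation \<open>[B, \<cdot>]\<close>, the adjoint of \<open>[B, A\<^sup>*]\<close> is \<open>[- B\<^sup>*, A]\<close>, so the trace-free
  matrix \<open>- B\<^sup>*\<close> induces the same derivation as \<open>B\<close> and uniqueness applies.\<close>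

lemma matrix_rep_antihermitian:
  assumes "hermitian_derivation mat_scale (**) conj_transpose (D x)"
  shows "conj_transpose (matrix_rep D x) = - matrix_rep D x"
proof -
  have der: "derivation mat_scale (**) (D x)"
    and herm: "\<And>A. D x (conj_transpose A) = conj_transpose (D x A)"
    using assms by (auto simp: hermitian_derivation_def)
  define B where "B = matrix_rep D x"
  define C where "C = - conj_transpose B"
  have "trace C = - cnj (trace B)"
    by (simp add: C_def trace_def sum_negf)
  then have "trace C = 0"
    using matrix_rep_properties(1)[of D x, OF der] by (simp add: B_def)
  moreover have "D x A = C ** A - A ** C" for A
  proof -
    have neg: "C ** A = - (conj_transpose B ** A)" "A ** C = - (A ** conj_transpose B)"
      by (simp_all add: C_def matrix_minus_mult)
    have "D x A = conj_transpose (D x (conj_transpose A))"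
      by (simp add: herm matrix_star_algebra.star_star)
    also have "\<dots> = A ** conj_transpose B - conj_transpose B ** A"
      by (simp add: matrix_rep_properties(2)[of D x, OF der] B_def matrix_star_algebra.star_mult
          matrix_star_algebra.star_star)
    finally show ?thesis
      by (simp add: neg)
  qed
  ultimately have "matrix_rep D x = C"
    by (rule matrix_rep_eqI[of D x, OF der])
  then have "B = - conj_transpose B"
    by (simp only: C_def B_def)
  then have "conj_transpose B = - B"
    by (metis minus_minus)
  then show ?thesis
    by (simp only: B_def)
qed

section \<open>Semilinear maps out of the module of a free real calculus\<close>

lemma generates_module_induct:
  assumes "generates_module act X"
    and "right_submodule act {m. P m}" "\<And>x. x \<in> X \<Longrightarrow> P x"
  shows "P m"
proof -
  have "right_submodule act hull X \<subseteq> {m. P m}"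
    using assms by (intro hull_minimal) auto
  then show ?thesis
    using assms(1) by (auto simp: generates_module_def)
qed

lemma (in right_module) act_zero: "act 0 a = 0" "act m 0 = 0"
  using act_add_left[of 0 0] act_add_right[of _ 0 0] by auto

lemma (in right_module) act_sum: "act (sum v I) a = (\<Sum>i\<in>I. act (v i) a)"
  by (induction I rule: infinite_finite_induct) (auto simp: act_zero act_add_left)

lemma (in right_module) act_diff_right: "act m (a - b) = act m a - act m b"
  using act_add_right[of m "a - b" b] by (simp add: algebra_simps)

lemma (in right_module) module_basis_expansion:
  assumes "module_basis act I v"
  shows "\<exists>c. m = (\<Sum>i\<in>I. act (v i) (c i))"
proof -
  define lin where "lin c = (\<Sum>i\<in>I. act (v i) (c i))" for c
  have gen: "generates_module act (v ` I)" and fin: "finite I"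
    using assms by (auto simp: module_basis_def)
  have "0 = lin (\<lambda>_. 0)"
    by (simp add: lin_def act_zero)
  moreover have "lin c + lin d = lin (\<lambda>i. c i + d i)" for c d
    by (simp add: lin_def act_add_right sum.distrib)
  moreover have "act (lin c) a = lin (\<lambda>i. mul (c i) a)" for c a
    by (simp add: lin_def act_sum act_mult)
  ultimately have sub: "right_submodule act {m. \<exists>c. m = lin c}"
    unfolding right_submodule_def by blast
  have "v j = lin (\<lambda>i. if i = j then one else 0)" if "j \<in> I" for j
  proof -
    have "lin (\<lambda>i. if i = j then one else 0) = (\<Sum>i\<in>I. if i = j then v j else 0)"
      unfolding lin_def by (intro sum.cong) (auto simp: act_one act_zero)
    then show ?thesis
      using that fin by simp
  qed
  then have "\<exists>c. x = lin c" if "x \<in> v ` I" for x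
    using that by blast
  then have "\<exists>c. m = lin c"
    by (rule generates_module_induct[OF gen sub])
  then show ?thesis
    by (simp add: lin_def)
qed

lemma real_basis_expansion:
  assumes "real_basis B"
  shows "\<exists>r. x = (\<Sum>b\<in>B. r b *\<^sub>R b)"
proof -
  have "x \<in> span B" "finite B"
    using assms by (auto simp: real_basis_def)
  then show ?thesis
    by (auto simp: span_finite)
qed

text \<open>A semilinear map is determined by its values on a module basis \<open>(\<phi> b)\<^bsub>b \<in> B\<^esub>\<close>, where they may be
  prescribed. Here they are the \<open>\<eta> b\<close>. That the resulting map sends \<open>\<phi> x\<close> to \<open>\<eta> x\<close> also for
  \<open>x \<notin> B\<close> rests on \<open>B\<close> being a basis of the Lie algebra: the module coordinates of
  \<open>\<phi> x\<close> are then the real coordinates of \<open>x\<close>, which \<open>f\<close> fixes.\<close>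

lemma (in free_real_calculus) semilinear_extension:
  assumes f_add: "\<And>a b. f (a + b) = f a + f b"
    and f_mul: "\<And>a b. f (mul a b) = mul (f a) (f b)"
    and f_real: "\<And>r. f (sc (complex_of_real r) one) = sc (complex_of_real r) one"
    and \<eta>_add: "\<And>x y. \<eta> (x + y) = \<eta> x + \<eta> y"
    and \<eta>_scaleR: "\<And>r x. \<eta> (r *\<^sub>R x) = act (\<eta> x) (sc (complex_of_real r) one)"
  shows "\<exists>h. (\<forall>m m'. h (m + m') = h m + h m') \<and> (\<forall>m a. h (act m a) = act (h m) (f a)) \<and>
    (\<forall>x. h (\<phi> x) = \<eta> x)"
proof -
  obtain B where B: "real_basis B" "module_basis act B \<phi>"
    using free_basis by blast
  define lin where "lin c = (\<Sum>b\<in>B. act (\<phi> b) (c b))" for c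
  obtain coord where coord: "\<And>m. lin (coord m) = m"
    using module_basis_expansion[OF B(2)] unfolding lin_def by metis
  define h where "h m = (\<Sum>b\<in>B. act (\<eta> b) (f (coord m b)))" for m
  \<comment> \<open>Since coordinates are unique, \<open>h\<close> may be computed from any expansion.\<close>
  have h_lin: "h (lin c) = (\<Sum>b\<in>B. act (\<eta> b) (f (c b)))" for c
  proof -
    have "lin (\<lambda>b. coord (lin c) b - c b) = lin (coord (lin c)) - lin c"
      by (simp add: lin_def act_diff_right sum_subtractf)
    also have "\<dots> = 0"
      by (simp add: coord)
    finally have "lin (\<lambda>b. coord (lin c) b - c b) = 0" .
    moreover have "\<forall>b\<in>B. e b = 0" if "lin e = 0" for e
      using B(2) that by (simp add: module_basis_def lin_def)
    ultimately have "\<forall>b\<in>B. coord (lin c) b - c b = 0"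
      by blast
    then show ?thesis
      by (simp add: h_def)
  qed
  have "h (m + m') = h m + h m'" for m m'
  proof -
    have "m + m' = lin (\<lambda>b. coord m b + coord m' b)"
      using coord[of m] coord[of m'] by (simp add: lin_def act_add_right sum.distrib)
    then show ?thesis
      by (simp add: h_lin f_add act_add_right sum.distrib) (simp add: h_def)
  qed
  moreover have "h (act m a) = act (h m) (f a)" for m a
  proof -
    have "act m a = act (lin (coord m)) a"
      by (simp add: coord)
    also have "\<dots> = lin (\<lambda>b. mul (coord m b) a)"
      by (simp add: lin_def act_mult act_sum)
    finally show ?thesis
      by (simp add: h_lin f_mul act_mult act_sum) (simp add: h_def act_sum)
  qed
  moreover have "h (\<phi> x) = \<eta> x" for x
  proof -
    obtain r where r: "x = (\<Sum>b\<in>B. r b *\<^sub>R b)"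
      using real_basis_expansion[OF B(1)] by blast
    have expand: "\<theta> x = (\<Sum>b\<in>B. act (\<theta> b) (sc (complex_of_real (r b)) one))"
      if add: "\<And>x y. \<theta> (x + y) = \<theta> x + \<theta> y"
        and scl: "\<And>r x. \<theta> (r *\<^sub>R x) = act (\<theta> x) (sc (complex_of_real r) one)" for \<theta> :: "_ \<Rightarrow> 'c"
    proof -
      have "\<theta> 0 = 0"
        using add[of 0 0] by simp
      then have "\<theta> (\<Sum>b\<in>I. r b *\<^sub>R b) = (\<Sum>b\<in>I. \<theta> (r b *\<^sub>R b))" for I
        by (induction I rule: infinite_finite_induct) (auto simp: add)
      then show ?thesis
        by (simp add: r scl)
    qed
    have "\<phi> x = lin (\<lambda>b. sc (complex_of_real (r b)) one)"
      unfolding lin_def by (rule expand) (rule \<phi>_add \<phi>_scaleR)+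
    then have "h (\<phi> x) = (\<Sum>b\<in>B. act (\<eta> b) (sc (complex_of_real (r b)) one))"
      by (simp add: h_lin f_real)
    also have "\<dots> = \<eta> x"
      by (rule expand[symmetric]) (rule \<eta>_add \<eta>_scaleR)+
    finally show ?thesis .
  qed
  ultimately show ?thesis by blast
qed

lemma (in real_calculus) semilinear_inverse:
  assumes h_add: "\<And>m m'. h (m + m') = h m + h m'"
    and h_act: "\<And>m a. h (act m a) = act (h m) (f a)"
    and k_add: "\<And>m m'. k (m + m') = k m + k m'"
    and k_act: "\<And>m a. k (act m a) = act (k m) (g a)"
    and gf: "\<And>a. g (f a) = a"
    and on_range: "\<And>x. k (h (\<phi> x)) = \<phi> x"
  shows "k (h m) = m"
proof (rule generates_module_induct[OF \<phi>_generates, where P = "\<lambda>m. k (h m) = m"])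
  have "h 0 = 0" "k 0 = 0"
    using h_add[of 0 0] k_add[of 0 0] by auto
  then show "right_submodule act {m. k (h m) = m}"
    by (simp add: right_submodule_def h_add k_add h_act k_act gf)
qed (auto simp: on_range)

text \<open>The semilinear extension exists in both directions because both calculi are free, so neither
  map has to be shown injective or surjective by hand.\<close>

lemma free_real_calculus_semilinear_iso:
  assumes "free_real_calculus sc mul one star bracket act D \<phi>"
    and "free_real_calculus sc mul one star bracket act D' \<phi>'"
    and f: "star_automorphism sc mul one star f"
    and \<psi>: "lie_automorphism bracket \<psi>"
  shows "\<exists>h. bij h \<and> (\<forall>m m'. h (m + m') = h m + h m') \<and>
    (\<forall>m a. h (act m a) = act (h m) (f a)) \<and> (\<forall>\<delta>. h (\<phi> (\<psi> \<delta>)) = \<phi>' \<delta>)"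
proof -
  interpret C: free_real_calculus sc mul one star bracket act D \<phi> by fact
  interpret C': free_real_calculus sc mul one star bracket act D' \<phi>' by fact
  define g where "g = inv f"
  define \<rho> where "\<rho> = inv \<psi>"
  have "bij f" and f_hom: "\<And>a b. f (a + b) = f a + f b" "\<And>a b. f (mul a b) = mul (f a) (f b)"
    "\<And>r. f (sc r one) = sc r one"
    using f by (auto simp: star_automorphism_def)
  then have fg: "f (g a) = a" and gf: "g (f a) = a" for a
    by (auto simp: g_def bij_is_surj surj_f_inv_f bij_is_inj)
  have g_hom: "g (a + b) = g a + g b" "g (mul a b) = mul (g a) (g b)" "g (sc r one) = sc r one"
    for a b r
    by (metis f_hom fg gf)+
  have "bij \<psi>" and lin: "linear \<psi>"
    using \<psi> by (auto simp: lie_automorphism_def)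
  then have \<psi>\<rho>: "\<psi> (\<rho> x) = x" and \<rho>\<psi>: "\<rho> (\<psi> x) = x" for x
    by (auto simp: \<rho>_def bij_is_surj surj_f_inv_f bij_is_inj)
  have \<rho>_lin: "\<rho> (x + y) = \<rho> x + \<rho> y" "\<rho> (r *\<^sub>R x) = r *\<^sub>R \<rho> x" for x y r
    using \<rho>\<psi>[of "\<rho> x + \<rho> y"] \<rho>\<psi>[of "r *\<^sub>R \<rho> x"]
    by (simp_all add: linear_add[OF lin] linear_scale[OF lin] \<psi>\<rho>)
  obtain h where h: "\<And>m m'. h (m + m') = h m + h m'" "\<And>m a. h (act m a) = act (h m) (f a)"
    "\<And>x. h (\<phi> x) = \<phi>' (\<rho> x)"
    using C.semilinear_extension[of f "\<lambda>x. \<phi>' (\<rho> x)"]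
    by (auto simp: f_hom \<rho>_lin C'.\<phi>_add C'.\<phi>_scaleR)
  obtain k where k: "\<And>m m'. k (m + m') = k m + k m'" "\<And>m a. k (act m a) = act (k m) (g a)"
    "\<And>x. k (\<phi>' x) = \<phi> (\<psi> x)"
    using C'.semilinear_extension[of g "\<lambda>x. \<phi> (\<psi> x)"]
    by (auto simp: g_hom linear_add[OF lin] linear_scale[OF lin] C.\<phi>_add C.\<phi>_scaleR)
  have "k (h m) = m" for m
    by (rule C.semilinear_inverse[OF h(1,2) k(1,2) gf]) (simp add: h(3) k(3) \<psi>\<rho>)
  moreover have "h (k m) = m" for m
    by (rule C'.semilinear_inverse[OF k(1,2) h(1,2) fg]) (simp add: h(3) k(3) \<rho>\<psi>)
  ultimately have "bij h"
    by (intro o_bij[of k]) (auto simp: fun_eq_iff)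
  then show ?thesis
    using h \<rho>\<psi> by (intro exI[of _ h]) auto
qed

section \<open>Isomorphism and quasi-equivalence\<close>

lemma matrix_calculus_derivation:
  assumes "matrix_free_real_calculus bracket act D \<phi>"
  shows "hermitian_derivation mat_scale (**) conj_transpose (D x)"
    and "derivation mat_scale (**) (D x)"
proof -
  interpret free_real_calculus mat_scale "(**)" "mat 1" conj_transpose bracket act D \<phi> by fact
  show "hermitian_derivation mat_scale (**) conj_transpose (D x)"
    by (rule D_hermitian)
  then show "derivation mat_scale (**) (D x)"
    by (simp add: hermitian_derivation_def)
qed

lemma unitary_conjugation_star_automorphism:
  fixes W :: "complex^'n^'n"
  assumes W: "conj_transpose W ** W = mat 1" "W ** conj_transpose W = mat 1"
  shows "star_automorphism mat_scale (**) (mat 1) conj_transpose (\<lambda>A. conj_transpose W ** A ** W)"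
proof -
  let ?f = "\<lambda>A. conj_transpose W ** A ** W" and ?g = "\<lambda>A. W ** A ** conj_transpose W"
  have "?g (?f A) = (W ** conj_transpose W) ** A ** (W ** conj_transpose W)" for A
    by (simp add: matrix_mul_assoc)
  moreover have "?f (?g A) = (conj_transpose W ** W) ** A ** (conj_transpose W ** W)" for A
    by (simp add: matrix_mul_assoc)
  ultimately have "bij ?f"
    by (intro o_bij[of ?g]) (auto simp: fun_eq_iff W)
  moreover have "?f (A ** B) = ?f A ** ?f B" for A B
  proof -
    have "?f A ** ?f B = conj_transpose W ** A ** (W ** conj_transpose W) ** B ** W"
      by (simp add: matrix_mul_assoc)
    then show ?thesis
      by (simp add: W matrix_mul_assoc)
  qed
  ultimately show ?thesis
    by (simp add: star_automorphism_def W matrix_star_algebra.mult_add_left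
        matrix_star_algebra.mult_add_right matrix_star_algebra.mult_scale_left
        matrix_star_algebra.mult_scale_right matrix_star_algebra.star_mult
        matrix_star_algebra.star_star matrix_mul_assoc)
qed

theorem theorem4p4:
  fixes bracket :: "'g::real_vector \<Rightarrow> 'g \<Rightarrow> 'g"
    and act :: "'m::ab_group_add \<Rightarrow> complex^'n^'n \<Rightarrow> 'm"
    and D D' :: "'g \<Rightarrow> complex^'n^'n \<Rightarrow> complex^'n^'n"
    and \<phi> \<phi>' :: "'g \<Rightarrow> 'm"
  assumes "matrix_free_real_calculus bracket act D \<phi>"
    and "matrix_free_real_calculus bracket act D' \<phi>'"
  shows "matrix_real_calculus_isomorphic bracket act D \<phi> D' \<phi>' \<longleftrightarrow>
         quasi_equivalent bracket (matrix_rep D) (matrix_rep D')"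
proof
  note der = matrix_calculus_derivation(2)[OF assms(1)]
  note der' = matrix_calculus_derivation(2)[OF assms(2)]
  note rep = matrix_rep_properties(2)[of D, OF der]
  note rep' = matrix_rep_properties(2)[of D', OF der']
  {
    assume "matrix_real_calculus_isomorphic bracket act D \<phi> D' \<phi>'"
    then obtain f \<psi> where f: "star_automorphism mat_scale (**) (mat 1) conj_transpose f"
      and \<psi>: "lie_automorphism bracket \<psi>"
      and compat: "\<And>\<delta> a. f (D (\<psi> \<delta>) a) = D' \<delta> (f a)"
      unfolding real_calculus_isomorphic_def by blast
    have "bij f" and f_hom: "\<And>A B. f (A + B) = f A + f B"
      "\<And>z A. f (mat_scale z A) = mat_scale z (f A)" "\<And>A B. f (A ** B) = f A ** f B"
      using f by (auto simp: star_automorphism_def)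
    then obtain U where U: "invertible U" "\<And>A. f A = matrix_inv U ** A ** U"
      using matrix_algebra_endomorphism_inner[of f] by (auto simp: bij_is_inj)
    have "matrix_rep D' x = matrix_inv U ** matrix_rep D (\<psi> x) ** U" for x
    proof (rule matrix_rep_eqI[of D', OF der'])
      have "trace (matrix_inv U ** matrix_rep D (\<psi> x) ** U) =
          trace (U ** (matrix_inv U ** matrix_rep D (\<psi> x)))"
        by (rule trace_mul_sym)
      then show "trace (matrix_inv U ** matrix_rep D (\<psi> x) ** U) = 0"
        using matrix_rep_properties(1)[of D, OF der]
        by (simp add: matrix_mul_assoc matrix_inv_mult[OF U(1)])
      fix A
      \<comment> \<open>The compatibility of \<open>f\<close> with the derivations describes \<open>D'\<close> only on values of \<open>f\<close>.\<close>
      obtain C where C: "A = f C"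
        using \<open>bij f\<close> by (metis bij_pointE)
      have f_diff: "f (S - T) = f S - f T" for S T
        using f_hom(1)[of "S - T" T] by simp
      have "D' x A = f (matrix_rep D (\<psi> x)) ** A - A ** f (matrix_rep D (\<psi> x))"
        by (simp add: C rep f_diff f_hom(3) flip: compat)
      then show "D' x A = matrix_inv U ** matrix_rep D (\<psi> x) ** U ** A -
          A ** (matrix_inv U ** matrix_rep D (\<psi> x) ** U)"
        by (simp only: U(2)[of "matrix_rep D (\<psi> x)"])
    qed
    then show "quasi_equivalent bracket (matrix_rep D) (matrix_rep D')"
      unfolding quasi_equivalent_def using U(1) \<psi> by blast
  }
  {
    assume "quasi_equivalent bracket (matrix_rep D) (matrix_rep D')"
    then obtain U \<psi> where U: "invertible U" and \<psi>: "lie_automorphism bracket \<psi>"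
      and sim: "\<And>x. matrix_rep D' x = matrix_inv U ** matrix_rep D (\<psi> x) ** U"
      unfolding quasi_equivalent_def by blast
    obtain W where W: "conj_transpose W ** W = mat 1" "W ** conj_transpose W = mat 1"
      and sim': "\<And>x. matrix_rep D' x = conj_transpose W ** matrix_rep D (\<psi> x) ** W"
      using similar_antihermitian_unitarily_equivalent[OF U _ _ sim]
        matrix_rep_antihermitian matrix_calculus_derivation(1)[OF assms(1)]
        matrix_calculus_derivation(1)[OF assms(2)] by metis
    define f where "f A = conj_transpose W ** A ** W" for A
    have f: "star_automorphism mat_scale (**) (mat 1) conj_transpose f"
      using unitary_conjugation_star_automorphism[OF W] unfolding f_def .
    then have f_hom: "f (A + B) = f A + f B" "f (A ** B) = f A ** f B" for A B
      by (auto simp: star_automorphism_def)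
    have f_diff: "f (S - T) = f S - f T" for S T
      using f_hom(1)[of "S - T" T] by simp
    have "f (D (\<psi> \<delta>) a) = D' \<delta> (f a)" for \<delta> a
      by (simp add: rep rep' f_diff f_hom(2) sim' flip: f_def)
    then show "matrix_real_calculus_isomorphic bracket act D \<phi> D' \<phi>'"
      unfolding real_calculus_isomorphic_def
      using f \<psi> free_real_calculus_semilinear_iso[OF assms f \<psi>] by blast
  }
qed

end
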